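(* For an integer $h\geq 1$ let $\Gamma_{3^h}$ denote the multiplicative circulant graph $MC(3^h)$, and let $\Gamma_{3^0}$ denote the one-vertex graph. Let $h$ be a positive integer. Then $$d_{\Gamma_{3^h}}(0,j)=\begin{cases} d_{\Gamma_{3^{h-1}}}(0,j) & \text{if } j=0,1,2,\ldots,\tfrac{3^{h-1}-1}{2},\\ d_{\Gamma_{3^{h-1}}}(0,j)+1 & \text{if } j=\tfrac{3^{h-1}-1}{2}+1,\ldots,3^{h-1}-1.\end{cases}$$ Moreover, if $k\in V(\Gamma_{3^h})$ is such that $k=3^{h-1}+j$ for some $j\in\{0,1,\ldots,\frac{3^{h-1}-1}{2}\}$, then $$d_{\Gamma_{3^h}}(0,k)=d_{\Gamma_{3^{h-1}}}(0,j)+1.$$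
   Context: For integers $m>1$, $h>0$, $MC(m^h)$ is the graph with vertex set $\mathbb{Z}_{m^h}$ in which distinct vertices $x,y$ are adjacent iff $x-y\equiv \pm m^i \pmod{m^h}$ for some $i\in\{0,\ldots,h-1\}$. $d_\Gamma(u,v)$ is the length of a shortest path between $u$ and $v$ in $\Gamma$. An integer $j$ used as a vertex of $\Gamma_{3^{k}}$ is identified with its residue modulo $3^{k}$. *)

theory Defs
  imports "Graph_Theory.Graph_Theory" "HOL-Number_Theory.Cong" "HOL-Library.Extended_Nat"
begin

text \<open>
  The vertex set \<open>\<int>\<^bsub>m^h\<^esub>\<close> is represented by the residues \<open>0, \<dots>, m^h - 1\<close>. An undirected
  edge appears as a pair of opposite arcs.
\<close>

definition MC :: "int \<Rightarrow> nat \<Rightarrow> int pair_pre_digraph" where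
  "MC m h = \<lparr> pverts = {0..<m ^ h},
     parcs = {(x, y). x \<in> {0..<m ^ h} \<and> y \<in> {0..<m ^ h} \<and> x \<noteq> y \<and>
       (\<exists>i<h. [x - y = m ^ i] (mod m ^ h) \<or> [x - y = - (m ^ i)] (mod m ^ h))} \<rparr>"

text \<open>The value is \<open>\<infinity>\<close> if there is no path between the two vertices.\<close>

definition graph_dist :: "('a, 'b) pre_digraph \<Rightarrow> 'a \<Rightarrow> 'a \<Rightarrow> enat" where
  "graph_dist G u v =
     (INF p \<in> {p. vpath p G \<and> hd p = u \<and> last p = v}. enat (vwalk_length p))"

lemma pair_graph_MC: "pair_graph (MC m h)"
proof
  show "finite (parcs (MC m h))"
    by (rule finite_subset[of _ "{0..<m ^ h} \<times> {0..<m ^ h}"]) (auto simp: MC_def)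
  have "(y, x) \<in> parcs (MC m h)" if "(x, y) \<in> parcs (MC m h)" for x y
  proof -
    have "[x - y = c] (mod m ^ h) \<longleftrightarrow> [y - x = - c] (mod m ^ h)" for c
      using cong_minus_minus_iff[of "x - y" c "m ^ h"] by simp
    then have "[y - x = m ^ i] (mod m ^ h) \<or> [y - x = - (m ^ i)] (mod m ^ h)"
      if "[x - y = m ^ i] (mod m ^ h) \<or> [x - y = - (m ^ i)] (mod m ^ h)" for i
      using that by fastforce
    then show ?thesis
      using that unfolding MC_def by auto
  qed
  then show "symmetric (MC m h)"
    by (auto simp: symmetric_def arcs_ends_def arc_to_ends_def sym_def)
qed (auto simp: MC_def)

text \<open>For \<open>h = 0\<close> the definition gives the one-vertex graph.\<close>

lemma MC_0: "MC m 0 = \<lparr> pverts = {0}, parcs = {} \<rparr>"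
  by (auto simp: MC_def)

end

theory Submission
  imports Defs
begin

text \<open>
  The distance from \<open>0\<close> in \<open>MC 3 h\<close> is the number of nonzero digits among the lowest \<open>h\<close> balanced
  ternary digits. This digit count changes by at most one along an edge, because carries never
  increase it, and clearing a nonzero digit is an edge that lowers it by one. The theorem compares
  the counts for \<open>h - 1\<close> and \<open>h\<close> digits: the integers of absolute value at most
  \<open>(3 ^ (h - 1) - 1) / 2\<close> are exactly those representable by \<open>h - 1\<close> balanced ternary digits,
  and adding \<open>3 ^ (h - 1)\<close> to one of them sets one further digit.
\<close>

section \<open>Graph distance read off from an integer potential\<close>

lemma vwalk_potential_le:
  fixes f :: "'a \<Rightarrow> nat"
  assumes "vwalk p G" and "\<And>x y. (x, y) \<in> arcs_ends G \<Longrightarrow> f y \<le> f x + 1"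
  shows "f (last p) \<le> f (hd p) + vwalk_length p"
  using assms(1)
proof (induction p rule: vwalk_induct)
  case (Cons u v es)
  then show ?case
    using assms(2)[of u v] by simp
qed simp

text \<open>Descending from \<open>v\<close> until the potential vanishes traces a path backwards to
  \<open>u\<close>. The bound on \<open>f\<close> along the path strengthens the induction: it shows
  that the new endpoint, of larger potential, has not been visited.\<close>

lemma vpath_descending_potential:
  fixes f :: "'a \<Rightarrow> nat"
  assumes zero: "\<And>x. x \<in> verts G \<Longrightarrow> f x = 0 \<Longrightarrow> x = u"
    and descent: "\<And>y. y \<in> verts G \<Longrightarrow> 0 < f y \<Longrightarrow>
          \<exists>x \<in> verts G. (x, y) \<in> arcs_ends G \<and> f x + 1 = f y"
    and v: "v \<in> verts G"
  shows "\<exists>p. vpath p G \<and> hd p = u \<and> last p = v \<and> length p = f v + 1 \<and> (\<forall>x \<in> set p. f x \<le> f v)"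
  using v
proof (induction "f v" arbitrary: v)
  case 0
  then have "v = u"
    using zero by metis
  then have "vpath [v] G \<and> hd [v] = u \<and> last [v] = v \<and> length [v] = f v + 1 \<and> (\<forall>x \<in> set [v]. f x \<le> f v)"
    using 0 by (auto simp: vpath_def vwalk_def)
  then show ?case by blast
next
  case (Suc n)
  then obtain w where w: "w \<in> verts G" "(w, v) \<in> arcs_ends G" "f w + 1 = f v"
    using descent[of v] by auto
  then obtain p where p: "vpath p G" "hd p = u" "last p = w" "length p = f w + 1" "\<forall>x \<in> set p. f x \<le> f w"
    using Suc.hyps by (metis Suc_eq_plus1 Suc_inject)
  then have "p \<noteq> []" by auto
  moreover have "v \<notin> set p"
    using p(5) w(3) by auto
  ultimately have "vpath (p @ [v]) G"
    using p w Suc.prems by (auto simp: vpath_def vwalk_def vwalk_arcs_append)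
  moreover have "\<forall>x \<in> set (p @ [v]). f x \<le> f v"
    using p(5) w(3) by auto
  ultimately show ?case
    using p \<open>p \<noteq> []\<close> w by (intro exI[of _ "p @ [v]"]) auto
qed

text \<open>The descending path gives the upper bound; the growth of \<open>f\<close> by at most one
  per arc gives the lower bound.\<close>

lemma graph_dist_eq_potential:
  fixes f :: "'a \<Rightarrow> nat"
  assumes "f u = 0"
    and "\<And>x. x \<in> verts G \<Longrightarrow> f x = 0 \<Longrightarrow> x = u"
    and "\<And>x y. (x, y) \<in> arcs_ends G \<Longrightarrow> f y \<le> f x + 1"
    and "\<And>y. y \<in> verts G \<Longrightarrow> 0 < f y \<Longrightarrow>
          \<exists>x \<in> verts G. (x, y) \<in> arcs_ends G \<and> f x + 1 = f y"
    and "v \<in> verts G"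
  shows "graph_dist G u v = enat (f v)"
proof (rule antisym)
  obtain p where "vpath p G" "hd p = u" "last p = v" "length p = f v + 1"
    using vpath_descending_potential[of G f u v] assms(2,4,5) by blast
  then show "graph_dist G u v \<le> enat (f v)"
    unfolding graph_dist_def by (intro INF_lower2[of p]) auto
next
  show "enat (f v) \<le> graph_dist G u v"
    unfolding graph_dist_def
  proof (rule INF_greatest)
    fix p assume "p \<in> {p. vpath p G \<and> hd p = u \<and> last p = v}"
    then show "enat (f v) \<le> enat (vwalk_length p)"
      using vwalk_potential_le[of p G f] assms(1,3) by (auto simp: vpath_def)
  qed
qed

section \<open>Counting nonzero balanced ternary digits\<close>

text \<open>
  The lowest balanced ternary digit of \<open>n\<close> is \<open>n - 3 * ((n + 1) div 3)\<close>, an element of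
  \<open>{-1, 0, 1}\<close>.
\<close>

fun bt_weight :: "nat \<Rightarrow> int \<Rightarrow> nat" where
  "bt_weight 0 n = 0"
| "bt_weight (Suc h) n = bt_weight h ((n + 1) div 3) + (if 3 dvd n then 0 else 1)"

text \<open>Multiples of \<open>3 ^ h\<close> do not touch the lowest \<open>h\<close> digits, so
  the count is well defined on residues.\<close>

lemma bt_weight_add_multiple: "bt_weight h (n + 3 ^ h * k) = bt_weight h n"
proof (induction h arbitrary: n)
  case (Suc h)
  have "(n + 3 ^ Suc h * k + 1) div 3 = (n + 1) div 3 + 3 ^ h * k"
    by (simp add: algebra_simps)
  moreover have "3 dvd n + 3 ^ Suc h * k \<longleftrightarrow> 3 dvd n"
    by (simp add: dvd_add_left_iff mult.assoc)
  ultimately show ?case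
    using Suc by simp
qed simp

lemma bt_weight_cong: "[m = n] (mod 3 ^ h) \<Longrightarrow> bt_weight h m = bt_weight h n"
  using bt_weight_add_multiple by (metis cong_iff_lin)

lemma bt_weight_eq_0_iff: "bt_weight h n = 0 \<longleftrightarrow> 3 ^ h dvd n"
proof (induction h arbitrary: n)
  case (Suc h)
  show ?case
  proof (cases "3 dvd n")
    case True
    then obtain k where "n = 3 * k" ..
    then show ?thesis
      using Suc by simp
  next
    case False
    then have "\<not> 3 ^ Suc h dvd n"
      using dvd_trans[of 3 "3 ^ Suc h" n] by auto
    then show ?thesis
      using False by simp
  qed
qed simp

lemma bt_weight_add_unit_le: "\<bar>s\<bar> = 1 \<Longrightarrow> bt_weight h (n + s) \<le> bt_weight h n + 1"
proof (induction h arbitrary: n)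
  case (Suc h)
  let ?q = "(n + 1) div 3"
  from Suc.prems have "s = 1 \<or> s = -1"
    by linarith
  \<comment> \<open>Either there is no carry and only the lowest digit changes, or the lowest digit
    is \<open>s\<close> and \<open>s\<close> is carried. In the carry case that digit already
    counted, so it can contribute nothing more and the induction hypothesis covers the
    quotient.\<close>
  then have "(n + s + 1) div 3 = ?q \<or>
      (n + s + 1) div 3 = ?q + s \<and> \<not> 3 dvd n"
    by (elim disjE; hypsubst) presburger+
  then show ?case
    using Suc.IH[OF Suc.prems, of ?q] by auto
qed simp

lemma bt_weight_add_power_le:
  "\<bar>s\<bar> = 1 \<Longrightarrow> bt_weight h (n + s * 3 ^ i) \<le> bt_weight h n + 1"
proof (induction h arbitrary: n i)
  case (Suc h)
  show ?case
  proof (cases i)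
    case 0
    then show ?thesis
      using bt_weight_add_unit_le[OF Suc.prems, of "Suc h"] by simp
  next
    case (Suc j)
    have "(n + s * 3 ^ i + 1) div 3 = (n + 1) div 3 + s * 3 ^ j"
      using Suc by (simp add: algebra_simps)
    moreover have "3 dvd n + s * 3 ^ i \<longleftrightarrow> 3 dvd n"
      using Suc by (simp add: dvd_add_left_iff)
    ultimately show ?thesis
      using Suc.IH[OF Suc.prems, of "(n + 1) div 3" j] by simp
  qed
qed simp

lemma bt_weight_descent:
  "0 < bt_weight h n \<Longrightarrow> \<exists>i<h. \<exists>s. \<bar>s\<bar> = 1 \<and> bt_weight h (n + s * 3 ^ i) + 1 = bt_weight h n"
proof (induction h arbitrary: n)
  case (Suc h)
  show ?case
  proof (cases "3 dvd n")
    case True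
    then obtain k where k: "n = 3 * k" ..
    then have "0 < bt_weight h k"
      using Suc.prems by simp
    then obtain i s where i: "i < h" "\<bar>s\<bar> = 1" "bt_weight h (k + s * 3 ^ i) + 1 = bt_weight h k"
      using Suc.IH by blast
    have "(n + s * 3 ^ Suc i + 1) div 3 = k + s * 3 ^ i" "3 dvd n + s * 3 ^ Suc i"
      unfolding k by simp_all
    then have "bt_weight (Suc h) (n + s * 3 ^ Suc i) + 1 = bt_weight (Suc h) n"
      using i(3) k by simp
    then show ?thesis
      using i(1,2) Suc_less_eq by blast
  next
    case False
    \<comment> \<open>\<open>s\<close> is the negative of the lowest digit; adding it clears that
      digit and keeps the quotient.\<close>
    define s where "s = 3 * ((n + 1) div 3) - n"
    have s: "\<bar>s\<bar> = 1"
      using False unfolding s_def by presburger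
    have "n + s * 3 ^ 0 = 3 * ((n + 1) div 3)"
      by (simp add: s_def)
    then have "bt_weight (Suc h) (n + s * 3 ^ 0) + 1 = bt_weight (Suc h) n"
      using False by simp
    then show ?thesis
      using s by blast
  qed
qed simp

section \<open>The digit count as distance from 0\<close>

lemma graph_dist_MC_3:
  assumes "j \<in> {0..<3 ^ h}"
  shows "graph_dist (MC 3 h) 0 j = enat (bt_weight h j)"
proof (rule graph_dist_eq_potential)
  show "bt_weight h 0 = 0"
    by (simp add: bt_weight_eq_0_iff)
  show "x = 0" if "x \<in> verts (MC 3 h)" "bt_weight h x = 0" for x
    using that zdvd_not_zless[of x "3 ^ h"] by (force simp: MC_def bt_weight_eq_0_iff)
  show "bt_weight h y \<le> bt_weight h x + 1" if "(x, y) \<in> arcs_ends (MC 3 h)" for x y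
  proof -
    from that obtain i where "[x - y = 3 ^ i] (mod 3 ^ h) \<or> [x - y = - (3 ^ i)] (mod 3 ^ h)"
      by (auto simp: MC_def)
    then obtain s :: int where s: "\<bar>s\<bar> = 1" "[x - y = - s * 3 ^ i] (mod 3 ^ h)"
      by (elim disjE) (auto intro: that[of "-1"] that[of 1])
    then have "[y = x + s * 3 ^ i] (mod 3 ^ h)"
      by (simp add: cong_iff_dvd_diff dvd_diff_commute algebra_simps)
    then show ?thesis
      using bt_weight_add_power_le[OF s(1)] bt_weight_cong by metis
  qed
  show "\<exists>x \<in> verts (MC 3 h). (x, y) \<in> arcs_ends (MC 3 h) \<and> bt_weight h x + 1 = bt_weight h y"
    if y: "y \<in> verts (MC 3 h)" "0 < bt_weight h y" for y
  proof -
    obtain i s where i: "i < h" "\<bar>s\<bar> = 1" "bt_weight h (y + s * 3 ^ i) + 1 = bt_weight h y"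
      using bt_weight_descent[OF y(2)] by blast
    define x where "x = (y + s * 3 ^ i) mod 3 ^ h"
    have x: "[x = y + s * 3 ^ i] (mod 3 ^ h)"
      by (simp add: x_def cong_def)
    have wx: "bt_weight h x + 1 = bt_weight h y"
      using bt_weight_cong[OF x] i(3) by simp
    have "[x - y = s * 3 ^ i] (mod 3 ^ h)"
      using x by (simp add: cong_iff_dvd_diff algebra_simps)
    moreover have "s = 1 \<or> s = -1"
      using i(2) by linarith
    ultimately have "[x - y = 3 ^ i] (mod 3 ^ h) \<or> [x - y = - (3 ^ i)] (mod 3 ^ h)"
      by auto
    \<comment> \<open>The two vertices differ because their weights do.\<close>
    moreover have "x \<in> {0..<3 ^ h}" "x \<noteq> y"
      using wx by (auto simp: x_def)
    ultimately show ?thesis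
      using y(1) i(1) wx by (auto simp: MC_def)
  qed
  show "j \<in> verts (MC 3 h)"
    using assms by (simp add: MC_def)
qed

section \<open>Comparing the counts for consecutive numbers of digits\<close>

text \<open>The quotient is \<open>n / 3\<close> rounded to the nearest integer. The rounding error
  leaves room for equality with \<open>N\<close>, which parity excludes.\<close>

lemma balanced_div_3_less:
  fixes n N :: int
  assumes "odd N" and "2 * \<bar>n\<bar> < 3 * N"
  shows "2 * \<bar>(n + 1) div 3\<bar> < N"
proof -
  have "\<bar>n - 3 * ((n + 1) div 3)\<bar> \<le> 1"
    by presburger
  then have "2 * \<bar>(n + 1) div 3\<bar> \<le> N"
    using assms(2) by linarith
  moreover have "2 * \<bar>(n + 1) div 3\<bar> \<noteq> N"
    using assms(1) by auto
  ultimately show ?thesis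
    by linarith
qed

text \<open>Removing the lowest digit keeps the number in the balanced range, so after
  \<open>h\<close> removals only 0 is left: the digit at position \<open>h\<close> is 0.\<close>

lemma bt_weight_Suc_small:
  "2 * \<bar>n\<bar> < 3 ^ h \<Longrightarrow> bt_weight (Suc h) n = bt_weight h n"
proof (induction h arbitrary: n)
  case (Suc h)
  have "2 * \<bar>(n + 1) div 3\<bar> < 3 ^ h"
    using Suc.prems by (intro balanced_div_3_less) simp_all
  then show ?case
    using Suc.IH[of "(n + 1) div 3"] by simp
next
  case 0
  then have "n = 0"
    by simp
  then show ?case
    by simp
qed

lemma bt_weight_Suc_add_power:
  "2 * \<bar>n\<bar> < 3 ^ h \<Longrightarrow> bt_weight (Suc h) (n + 3 ^ h) = bt_weight h n + 1"
proof (induction h arbitrary: n)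
  case (Suc h)
  have "2 * \<bar>(n + 1) div 3\<bar> < 3 ^ h"
    using Suc.prems by (intro balanced_div_3_less) simp_all
  moreover have "(n + 3 ^ Suc h + 1) div 3 = (n + 1) div 3 + 3 ^ h"
    by (simp add: algebra_simps)
  moreover have "3 dvd n + 3 ^ Suc h \<longleftrightarrow> 3 dvd n"
    by (simp add: dvd_add_left_iff)
  ultimately show ?case
    using Suc.IH[of "(n + 1) div 3"] by simp
next
  case 0
  then have "n = 0"
    by simp
  then show ?case
    by simp
qed

theorem theorem3p14:
  fixes h :: nat
  assumes "h > 0"
  shows "(\<forall>j::int. 0 \<le> j \<and> j \<le> (3 ^ (h - 1) - 1) div 2 \<longrightarrow>
            graph_dist (MC 3 h) 0 j = graph_dist (MC 3 (h - 1)) 0 j) \<and>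
         (\<forall>j::int. (3 ^ (h - 1) - 1) div 2 + 1 \<le> j \<and> j \<le> 3 ^ (h - 1) - 1 \<longrightarrow>
            graph_dist (MC 3 h) 0 j = graph_dist (MC 3 (h - 1)) 0 j + 1) \<and>
         (\<forall>k j::int. k \<in> verts (MC 3 h) \<and> 0 \<le> j \<and> j \<le> (3 ^ (h - 1) - 1) div 2 \<and>
              k = 3 ^ (h - 1) + j \<longrightarrow>
            graph_dist (MC 3 h) 0 k = graph_dist (MC 3 (h - 1)) 0 j + 1)"
proof -
  from assms obtain g where h: "h = Suc g"
    using gr0_implies_Suc by blast
  define N :: int where "N = 3 ^ g"
  have N: "odd N" "N > 0"
    by (simp_all add: N_def)
  have dist_g: "graph_dist (MC 3 g) 0 j = enat (bt_weight g j)" if "0 \<le> j" "j < N" for j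
    using that by (intro graph_dist_MC_3) (simp add: N_def)
  have dist_h: "graph_dist (MC 3 (Suc g)) 0 j = enat (bt_weight (Suc g) j)"
    if "0 \<le> j" "j < 3 * N" for j
    using that by (intro graph_dist_MC_3) (simp add: N_def)
  have half: "2 * j < N" "j < N" if "0 \<le> j" "j \<le> (N - 1) div 2" for j
    using that N by linarith+
  have "graph_dist (MC 3 (Suc g)) 0 j = graph_dist (MC 3 g) 0 j"
    if "0 \<le> j" "j \<le> (N - 1) div 2" for j
    using dist_g dist_h bt_weight_Suc_small[of j g] half[OF that] that N by (simp add: N_def)
  moreover have "graph_dist (MC 3 (Suc g)) 0 j = graph_dist (MC 3 g) 0 j + 1"
    if "(N - 1) div 2 + 1 \<le> j" "j \<le> N - 1" for j
  proof -
    from N(1) obtain M where "N = 2 * M + 1"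
      by (elim oddE)
    \<comment> \<open>In the upper half it is \<open>j - N\<close> that lies in the balanced range.
      Thus \<open>j\<close> has the \<open>g\<close> digits of \<open>j - N\<close> and a leading 1,
      while modulo \<open>N\<close> the two agree.\<close>
    with that N(2) have j: "2 * \<bar>j - N\<bar> < N" "0 \<le> j" "j < N"
      by auto
    have "bt_weight (Suc g) j = bt_weight g (j - N) + 1"
      using bt_weight_Suc_add_power[of "j - N" g] j(1) by (simp add: N_def)
    also have "bt_weight g (j - N) = bt_weight g j"
      using bt_weight_add_multiple[of g j "-1"] by (simp add: N_def)
    finally show ?thesis
      using dist_g dist_h j N by (simp add: one_enat_def)
  qed
  moreover have "graph_dist (MC 3 (Suc g)) 0 (N + j) = graph_dist (MC 3 g) 0 j + 1"
    if "0 \<le> j" "j \<le> (N - 1) div 2" for j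
  proof -
    have "bt_weight (Suc g) (N + j) = bt_weight g j + 1"
      using bt_weight_Suc_add_power[of j g] half[OF that] that by (simp add: N_def add.commute)
    then show ?thesis
      using dist_g dist_h half[OF that] that N by (simp add: one_enat_def)
  qed
  ultimately show ?thesis
    unfolding h by (auto simp: N_def)
qed

end
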